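(* Let $n$ be odd and let $X=(X_{ij})$ be the $n\times n$ matrix of indeterminates. Then $AT(n)$ is the coefficient of $(-1)^{\frac{n(n-1)}{2}}\prod_{i=1}^n\prod_{j=1}^nX_{ij}$ in the polynomial $\frac{1}{n!(n-1)!}\,\mathrm{per}(X)\det(X)^{n-1}$; that is, the coefficient of the monomial $\prod_{i=1}^n\prod_{j=1}^nX_{ij}$ in $\frac{1}{n!(n-1)!}\mathrm{per}(X)\det(X)^{n-1}$ equals $(-1)^{\frac{n(n-1)}{2}}AT(n)$.
   Context: $\mathrm{per}$ denotes the permanent. A Latin square of order $n$ is an $n\times n$ array with entries in $[n]$ in which each number appears exactly once in each row and each column. Viewing rows and columns as permutations of $[n]$, the sign of a Latin square is the product of the signs of all its rows and all its columns; it is even if its sign is $1$ and odd if $-1$. A Latin square is normalized if its first row is the identity permutation and unipotent if all entries on its main diagonal are equal. $AT(n)=U_n^{\mathrm{E}}-U_n^{\mathrm{O}}$, where $U_n^{\mathrm{E}}$ ($U_n^{\mathrm{O}}$) is the number of normalized unipotent even (odd) Latin squares of order $n$. *)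

theory Defs
  imports "Jordan_Normal_Form.Determinant" "HOL-Library.Poly_Mapping"
begin

definition per :: "'a::comm_ring_1 mat \<Rightarrow> 'a" where
  "per A = (if dim_row A = dim_col A
     then (\<Sum>p | p permutes {0..<dim_row A}. \<Prod>i = 0..<dim_row A. A $$ (i, p i))
     else 0)"

text \<open>The set \<open>[n]\<close> is rendered as \<open>{0..<n}\<close> for rows, columns and symbols alike, in line
  with the 0-based indexing of matrices. A square is a matrix rather than a function, so
  that squares of order \<open>n\<close> are determined by their \<open>n\<^sup>2\<close> entries and can be counted.\<close>

definition latin_square :: "nat \<Rightarrow> nat mat \<Rightarrow> bool" where
  "latin_square n L \<longleftrightarrow>
     L \<in> carrier_mat n n \<and>
     (\<forall>i<n. \<forall>j<n. L $$ (i, j) < n) \<and>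
     (\<forall>i<n. \<forall>k<n. \<exists>!j. j < n \<and> L $$ (i, j) = k) \<and>
     (\<forall>j<n. \<forall>k<n. \<exists>!i. i < n \<and> L $$ (i, j) = k)"

text \<open>Outside \<open>{0..<n}\<close> the row and column maps are the identity, as the library's
  \<^const>\<open>sign\<close> is defined for permutations of a whole type.\<close>

definition row_perm :: "nat \<Rightarrow> nat mat \<Rightarrow> nat \<Rightarrow> nat \<Rightarrow> nat" where
  "row_perm n L i = (\<lambda>j. if j < n then L $$ (i, j) else j)"

definition col_perm :: "nat \<Rightarrow> nat mat \<Rightarrow> nat \<Rightarrow> nat \<Rightarrow> nat" where
  "col_perm n L j = (\<lambda>i. if i < n then L $$ (i, j) else i)"

definition latin_sign :: "nat \<Rightarrow> nat mat \<Rightarrow> int" where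
  "latin_sign n L = (\<Prod>i<n. sign (row_perm n L i)) * (\<Prod>j<n. sign (col_perm n L j))"

definition normalized :: "nat \<Rightarrow> nat mat \<Rightarrow> bool" where
  "normalized n L \<longleftrightarrow> (\<forall>j<n. L $$ (0, j) = j)"

definition unipotent :: "nat \<Rightarrow> nat mat \<Rightarrow> bool" where
  "unipotent n L \<longleftrightarrow> (\<forall>i<n. \<forall>j<n. L $$ (i, i) = L $$ (j, j))"

definition U_even :: "nat \<Rightarrow> nat" where
  "U_even n = card {L. latin_square n L \<and> normalized n L \<and> unipotent n L \<and> latin_sign n L = 1}"

definition U_odd :: "nat \<Rightarrow> nat" where
  "U_odd n = card {L. latin_square n L \<and> normalized n L \<and> unipotent n L \<and> latin_sign n L = - 1}"

definition AT :: "nat \<Rightarrow> int" where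
  "AT n = int (U_even n) - int (U_odd n)"

text \<open>Polynomials in indeterminates indexed by \<open>'v\<close> form the monoid algebra of the finitely
  supported exponent vectors; the coefficient of a monomial is \<^const>\<open>Poly_Mapping.lookup\<close>.\<close>

type_synonym ('v, 'a) mpoly = "('v \<Rightarrow>\<^sub>0 nat) \<Rightarrow>\<^sub>0 'a"

definition mconst :: "'a::zero \<Rightarrow> ('v, 'a) mpoly" where
  "mconst c = Poly_Mapping.single 0 c"

definition mvar :: "'v \<Rightarrow> ('v, 'a::zero_neq_one) mpoly" where
  "mvar v = Poly_Mapping.single (Poly_Mapping.single v 1) 1"

definition X_mat :: "nat \<Rightarrow> (nat \<times> nat, rat) mpoly mat" where
  "X_mat n = mat n n (\<lambda>(i, j). mvar (i, j))"

text \<open>The exponent vector of the product of all \<open>n\<^sup>2\<close> indeterminates.\<close>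

definition all_vars_monom :: "nat \<Rightarrow> (nat \<times> nat) \<Rightarrow>\<^sub>0 nat" where
  "all_vars_monom n = (\<Sum>i<n. \<Sum>j<n. Poly_Mapping.single (i, j) 1)"

end

theory Submission imports Defs begin

text \<open>Expanding the product, the coefficient is a sum over all \<open>n\<close>-tuples of permutations whose
  graphs partition the cells, that is, over all Latin squares \<open>L\<close>, the \<open>k\<close>-th permutation being
  the set of cells of \<open>L\<close> that contain the symbol \<open>k\<close>. The summand is the product of the signs of
  the symbol permutations other than the one of the symbol \<open>0\<close>.

  The product of all row, column and symbol signs of a Latin square is \<open>(-1)\<close> to the power
  \<open>n(n-1)/2\<close>, so the summand is, up to this global sign, the sign of \<open>L\<close> times the sign of its
  symbol permutation \<open>p\<close> of \<open>0\<close>. Permuting the columns of \<open>L\<close> by \<open>p\<close> brings \<open>0\<close> to the diagonal and,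
  as \<open>n\<close> is odd, absorbs the factor \<open>sign p\<close>; renaming the nonzero symbols then normalizes the
  first row and does not change the sign. Every normalized unipotent square arises in this
  way from \<open>n! (n-1)!\<close> Latin squares.\<close>

subsection \<open>Signs of permutations of pairs\<close>

text \<open>Bundles a family of permutations into one permutation of pairs, so that the product of
  their signs becomes a single sign.\<close>

definition fibrewise :: "nat \<Rightarrow> (nat \<Rightarrow> 'a \<Rightarrow> 'a) \<Rightarrow> nat \<times> 'a \<Rightarrow> nat \<times> 'a" where
  "fibrewise m f = (\<lambda>(a, b). (a, if a < m then f a b else b))"

lemma fibrewise_Suc:
  assumes "f m permutes S"
  shows "fibrewise (Suc m) f = fibrewise m f \<circ> map_permutation S (Pair m) (f m)"
proof
  fix x
  have inj: "inj_on (Pair m) S" by (simp add: inj_on_def)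
  show "fibrewise (Suc m) f x = (fibrewise m f \<circ> map_permutation S (Pair m) (f m)) x"
  proof (cases "x \<in> Pair m ` S")
    case True
    then show ?thesis
      using inj by (auto simp: fibrewise_def map_permutation_def restrict_id_def)
  next
    case False
    \<comment> \<open>Over \<open>m\<close> but outside \<open>S\<close>, \<open>f m\<close> is the
      identity, in agreement with the transported copy.\<close>
    then have "fst x = m \<Longrightarrow> f m (snd x) = snd x"
      using assms by (cases x) (auto intro!: permutes_not_in)
    then show ?thesis
      using False by (cases x) (auto simp: fibrewise_def map_permutation_def restrict_id_def less_Suc_eq)
  qed
qed

text \<open>Each new index composes with a copy of \<open>f m\<close> carried to the fibre over
  \<open>m\<close>; transport along an injection preserves the sign.\<close>

lemma fibrewise_permutation_sign:
  assumes "finite S" "\<And>a. a < m \<Longrightarrow> f a permutes S"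
  shows "permutation (fibrewise m f) \<and> sign (fibrewise m f) = (\<Prod>a<m. sign (f a))"
  using assms(2)
proof (induction m)
  case 0
  have "fibrewise 0 f = id" by (auto simp: fibrewise_def)
  then show ?case by simp
next
  case (Suc m)
  have inj: "inj_on (Pair m) S" by (simp add: inj_on_def)
  have fm: "f m permutes S" using Suc.prems by simp
  have "map_permutation S (Pair m) (f m) permutes Pair m ` S"
    using map_permutation_permutes[OF _ fm] inj by (auto simp: bij_betw_def)
  then have perm: "permutation (map_permutation S (Pair m) (f m))"
    using assms(1) by (auto simp: permutation_permutes)
  show ?case
    using Suc perm sign_map_permutation[OF inj fm assms(1)]
    by (simp add: fibrewise_Suc[of f, OF fm] sign_compose permutation_compose del: comp_apply)
qed

section \<open>The sign of the transposition of the grid\<close>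

definition swap_below :: "nat \<Rightarrow> nat \<times> nat \<Rightarrow> nat \<times> nat" where
  "swap_below n = (\<lambda>(a, b). if a < n \<and> b < n then (b, a) else (a, b))"

text \<open>One transposition arises for every pair of cells mirrored in the diagonal, and there are
  \<open>n * (n - 1) div 2\<close> such pairs.\<close>

lemma swap_below_permutation_sign:
  "permutation (swap_below n) \<and> sign (swap_below n) = (- 1) ^ (n * (n - 1) div 2)"
proof (induction n)
  case 0
  have "swap_below 0 = id" by (auto simp: swap_below_def)
  then show ?case by simp
next
  case (Suc n)
  \<comment> \<open>\<open>t m\<close> interpolates between \<open>swap_below n\<close> and
    \<open>swap_below (Suc n)\<close>: of the new mirrored pairs \<open>(n, b)\<close>,
    \<open>(b, n)\<close> it swaps those with \<open>b < m\<close>. Each increment of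
    \<open>m\<close> costs one transposition.\<close>
  define t where "t m = (\<lambda>(a, b). if a < n \<and> b < n \<or> a = n \<and> b < m \<or> b = n \<and> a < m
    then (b, a) else (a, b))" for m
  have "permutation (t m) \<and> sign (t m) = sign (swap_below n) * (- 1) ^ m" if "m \<le> n" for m
    using that
  proof (induction m)
    case 0
    have "t 0 = swap_below n" by (auto simp: t_def swap_below_def)
    with Suc.IH show ?case by simp
  next
    case (Suc m)
    have "t (Suc m) = t m \<circ> Transposition.transpose (n, m) (m, n)"
      using Suc.prems by (auto simp: t_def fun_eq_iff Transposition.transpose_def)
    moreover have "permutation (t m)" "sign (t m) = sign (swap_below n) * (- 1) ^ m"
      using Suc by simp_all
    ultimately show ?case
      using Suc.prems
      by (simp add: sign_compose permutation_compose permutation_swap_id sign_swap_id del: comp_apply)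
  qed
  from this[of n] have "permutation (t n) \<and> sign (t n) = sign (swap_below n) * (- 1) ^ n"
    by simp
  moreover have "t n = swap_below (Suc n)"
    by (auto simp: t_def swap_below_def fun_eq_iff)
  moreover have "Suc n * (Suc n - 1) div 2 = n * (n - 1) div 2 + n"
  proof -
    have "Suc n * (Suc n - 1) = n * (n - 1) + n * 2" by (cases n) auto
    then show ?thesis by simp
  qed
  ultimately show ?case using Suc.IH by (simp add: power_add)
qed

subsection \<open>Row, column and symbol permutations of a Latin square\<close>

text \<open>The right-hand side has the shape of the row and column conditions of
  \<open>latin_square\<close>, which thereby become statements about permutations.\<close>

lemma if_less_permutes_iff:
  fixes n :: nat
  shows "(\<lambda>x. if x < n then f x else x) permutes {0..<n} \<longleftrightarrow>
    (\<forall>x<n. f x < n) \<and> (\<forall>k<n. \<exists>!x. x < n \<and> f x = k)" (is "?g permutes _ \<longleftrightarrow> ?R")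
proof
  assume g: "?g permutes {0..<n}"
  have lt: "f x < n" if "x < n" for x
    using permutes_in_image[OF g, of x] that by simp
  moreover have "\<exists>!x. x < n \<and> f x = k" if "k < n" for k
  proof -
    have "\<exists>!x. ?g x = k" using g by (simp add: permutes_def)
    then obtain x where x: "?g x = k" "\<And>y. ?g y = k \<Longrightarrow> y = x" by blast
    from x(1) that have "x < n" "f x = k" by (auto split: if_splits)
    moreover have "y = x" if "y < n \<and> f y = k" for y using x(2)[of y] that by simp
    ultimately show ?thesis by blast
  qed
  ultimately show ?R by blast
next
  assume R: ?R
  then have lt: "f x < n" if "x < n" for x using that by blast
  have "?g x = x" if "x \<notin> {0..<n}" for x using that by simp
  moreover have "\<exists>!x. ?g x = y" for y
  proof (cases "y < n")
    case True
    then have "\<exists>!x. x < n \<and> f x = y" using R by blast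
    then obtain x where x: "x < n" "f x = y" "\<And>z. z < n \<Longrightarrow> f z = y \<Longrightarrow> z = x" by blast
    show ?thesis
    proof (rule ex1I[of _ x])
      show "z = x" if "?g z = y" for z
        using that True x(3)[of z] by (simp split: if_splits)
    qed (use x(1,2) in simp)
  next
    case False
    show ?thesis
    proof (rule ex1I[of _ y])
      show "z = y" if "?g z = y" for z
      proof (cases "z < n")
        case True
        with that lt[OF True] False show ?thesis by simp
      next
        case False
        with that show ?thesis by simp
      qed
    qed (use False in simp)
  qed
  ultimately show "?g permutes {0..<n}" unfolding permutes_def by blast
qed

section \<open>Symbol permutations and the sign relation\<close>

definition symbol_perm :: "nat \<Rightarrow> nat mat \<Rightarrow> nat \<Rightarrow> nat \<Rightarrow> nat" where
  "symbol_perm n L k = (\<lambda>i. if i < n then THE j. j < n \<and> L $$ (i, j) = k else i)"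

lemma latin_square_iff_permutes:
  "latin_square n L \<longleftrightarrow> L \<in> carrier_mat n n \<and>
    (\<forall>i<n. row_perm n L i permutes {0..<n}) \<and> (\<forall>j<n. col_perm n L j permutes {0..<n})"
  unfolding latin_square_def row_perm_def col_perm_def if_less_permutes_iff by (rule iffI) simp_all

lemma symbol_perm_eq_iff:
  assumes "latin_square n L" "k < n" "i < n" "j < n"
  shows "symbol_perm n L k i = j \<longleftrightarrow> L $$ (i, j) = k"
proof -
  have "\<exists>!j. j < n \<and> L $$ (i, j) = k" using assms by (simp add: latin_square_def)
  from theI'[OF this] the1_equality[OF this, of j] show ?thesis
    using assms(3,4) by (auto simp: symbol_perm_def)
qed

lemma symbol_perm_less:
  assumes "latin_square n L" "k < n" "i < n"
  shows "symbol_perm n L k i < n"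
proof -
  have "\<exists>!j. j < n \<and> L $$ (i, j) = k" using assms by (simp add: latin_square_def)
  from theI'[OF this] show ?thesis using assms(3) by (simp add: symbol_perm_def)
qed

text \<open>The row condition makes the map well defined; bijectivity is the column condition, as
  \<open>k\<close> stands exactly once in each column.\<close>

lemma symbol_perm_permutes:
  assumes "latin_square n L" "k < n"
  shows "symbol_perm n L k permutes {0..<n}"
proof -
  have "\<exists>!i. i < n \<and> symbol_perm n L k i = j" if "j < n" for j
  proof -
    have "\<exists>!i. i < n \<and> L $$ (i, j) = k" using assms that by (simp add: latin_square_def)
    moreover have "(\<lambda>i. i < n \<and> symbol_perm n L k i = j) = (\<lambda>i. i < n \<and> L $$ (i, j) = k)"
      using symbol_perm_eq_iff[OF assms _ that] by auto
    ultimately show ?thesis by simp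
  qed
  then have "(\<lambda>i. if i < n then symbol_perm n L k i else i) permutes {0..<n}"
    using symbol_perm_less[OF assms] by (simp add: if_less_permutes_iff)
  moreover have "(\<lambda>i. if i < n then symbol_perm n L k i else i) = symbol_perm n L k"
    by (auto simp: symbol_perm_def)
  ultimately show ?thesis by simp
qed

lemma latin_square_entry_less:
  "latin_square n L \<Longrightarrow> i < n \<Longrightarrow> j < n \<Longrightarrow> L $$ (i, j) < n"
  by (simp add: latin_square_def)

text \<open>The three families, read as permutations of pairs, satisfy one relation involving the
  coordinate swap. The swap occurs twice on the left and once on the right, so its sign survives
  once.\<close>

lemma prod_symbol_perm_sign:
  assumes L: "latin_square n L"
  shows "(\<Prod>k<n. sign (symbol_perm n L k)) = (- 1) ^ (n * (n - 1) div 2) * latin_sign n L"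
proof -
  let ?A = "fibrewise n (row_perm n L)" and ?B = "fibrewise n (col_perm n L)"
    and ?C = "fibrewise n (symbol_perm n L)" and ?t = "swap_below n"
  \<comment> \<open>If \<open>k\<close> is the entry in cell \<open>(i, j)\<close>, both sides map \<open>(i, j)\<close> to \<open>(j, k)\<close>, the left one via
    \<open>(i, k)\<close>, \<open>(k, i)\<close> and \<open>(k, j)\<close>.\<close>
  have "?t \<circ> ?C \<circ> ?t \<circ> ?A = ?B \<circ> ?t"
  proof
    fix x :: "nat \<times> nat"
    obtain i j where x: "x = (i, j)" by (cases x)
    show "(?t \<circ> ?C \<circ> ?t \<circ> ?A) x = (?B \<circ> ?t) x"
    proof (cases "i < n \<and> j < n")
      case True
      have k: "L $$ (i, j) < n" using latin_square_entry_less[OF L] True by simp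
      have "symbol_perm n L (L $$ (i, j)) i = j"
        using symbol_perm_eq_iff[OF L k] True by simp
      with True k show ?thesis
        by (simp add: x fibrewise_def swap_below_def row_perm_def col_perm_def)
    next
      case False
      \<comment> \<open>Outside the grid each of these maps is the identity.\<close>
      then show ?thesis
        by (auto simp: x fibrewise_def swap_below_def row_perm_def col_perm_def symbol_perm_def)
    qed
  qed
  then have "sign (?t \<circ> ?C \<circ> ?t \<circ> ?A) = sign (?B \<circ> ?t)" by simp
  moreover have A: "permutation ?A \<and> sign ?A = (\<Prod>i<n. sign (row_perm n L i))"
    and B: "permutation ?B \<and> sign ?B = (\<Prod>j<n. sign (col_perm n L j))"
    and C: "permutation ?C \<and> sign ?C = (\<Prod>k<n. sign (symbol_perm n L k))"
    using L symbol_perm_permutes[OF L]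
    by (auto intro!: fibrewise_permutation_sign[of "{0..<n}"] simp: latin_square_iff_permutes)
  moreover note t = swap_below_permutation_sign[of n]
  ultimately have "sign ?t * sign ?C * sign ?t * sign ?A = sign ?B * sign ?t"
    by (simp add: sign_compose permutation_compose del: comp_apply)
  \<comment> \<open>Signs are their own inverses: the two signs of \<open>?t\<close> on the left
    cancel and that of \<open>?A\<close> moves across.\<close>
  then have "sign ?C = sign ?t * (sign ?A * sign ?B)"
    by (cases ?t rule: sign_cases; cases ?A rule: sign_cases; cases ?B rule: sign_cases) simp_all
  then show ?thesis using A B C t by (simp add: latin_sign_def)
qed

subsection \<open>Reduction to normalized unipotent squares\<close>

definition relabel :: "nat \<Rightarrow> (nat \<Rightarrow> nat) \<Rightarrow> (nat \<Rightarrow> nat) \<Rightarrow> nat mat \<Rightarrow> nat mat" where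
  "relabel n s p L = mat n n (\<lambda>(i, j). s (L $$ (i, p j)))"

context
  fixes n :: nat and s p :: "nat \<Rightarrow> nat" and L :: "nat mat"
  assumes s: "s permutes {0..<n}" and p: "p permutes {0..<n}" and L: "latin_square n L"
begin

lemma permutes_less_iff: "p j < n \<longleftrightarrow> j < n"
  using permutes_in_image[OF p, of j] by simp

lemma row_perm_relabel:
  assumes "i < n"
  shows "row_perm n (relabel n s p L) i = s \<circ> row_perm n L i \<circ> p"
  using assms permutes_not_in[OF s] permutes_not_in[OF p]
  by (auto simp: fun_eq_iff row_perm_def relabel_def permutes_less_iff)

lemma col_perm_relabel:
  assumes "j < n"
  shows "col_perm n (relabel n s p L) j = s \<circ> col_perm n L (p j)"
  using assms permutes_not_in[OF s] by (auto simp: fun_eq_iff col_perm_def relabel_def)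

lemma latin_square_relabel: "latin_square n (relabel n s p L)"
  unfolding latin_square_iff_permutes
proof (intro conjI allI impI)
  show "relabel n s p L \<in> carrier_mat n n" by (simp add: relabel_def)
  fix i assume "i < n"
  then show "row_perm n (relabel n s p L) i permutes {0..<n}"
    using L s p by (simp add: row_perm_relabel latin_square_iff_permutes permutes_compose)
next
  fix j assume "j < n"
  then show "col_perm n (relabel n s p L) j permutes {0..<n}"
    using L s permutes_less_iff by (simp add: col_perm_relabel latin_square_iff_permutes permutes_compose)
qed

text \<open>\<open>s\<close> contributes its sign once per row and once per column,
  \<open>2 * n\<close> times in all, and cancels. \<open>p\<close> contributes once per row and only
  reorders the columns.\<close>

lemma latin_sign_relabel: "latin_sign n (relabel n s p L) = sign p ^ n * latin_sign n L"
proof -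
  have perm: "permutation q" if "q permutes {0..<n}" for q :: "nat \<Rightarrow> nat"
    using that by (auto simp: permutation_permutes)
  have rows: "(\<Prod>i<n. sign (row_perm n (relabel n s p L) i))
      = (\<Prod>i<n. sign s * sign p * sign (row_perm n L i))"
    using L s p by (intro prod.cong)
      (auto simp: row_perm_relabel latin_square_iff_permutes sign_compose permutation_compose perm)
  have "(\<Prod>j<n. sign (col_perm n (relabel n s p L) j))
      = (\<Prod>j<n. sign s * sign (col_perm n L (p j)))"
    using L s permutes_less_iff by (intro prod.cong)
      (auto simp: col_perm_relabel latin_square_iff_permutes sign_compose perm)
  also have "\<dots> = sign s ^ n * (\<Prod>j<n. sign (col_perm n L (p j)))"
    by (simp add: prod.distrib)
  also have "(\<Prod>j<n. sign (col_perm n L (p j))) = (\<Prod>j<n. sign (col_perm n L j))"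
    using prod.permute[OF p, of "\<lambda>j. sign (col_perm n L j)"]
    by (simp add: comp_def atLeast0LessThan)
  finally have cols: "(\<Prod>j<n. sign (col_perm n (relabel n s p L) j))
      = sign s ^ n * (\<Prod>j<n. sign (col_perm n L j))" .
  have "sign s ^ n * sign s ^ n = 1"
    by (simp flip: power_mult_distrib)
  then show ?thesis
    unfolding latin_sign_def rows cols by (simp add: prod.distrib mult_ac)
qed

end


text \<open>The column maps compose in reverse because \<open>p\<close> acts on the index that is
  looked up, whereas \<open>s\<close> acts on the entry.\<close>

lemma relabel_relabel:
  assumes "p permutes {0..<n}"
  shows "relabel n s p (relabel n s' p' L) = relabel n (s \<circ> s') (p' \<circ> p) L"
  using permutes_in_image[OF assms] by (intro eq_matI) (auto simp: relabel_def)

lemma relabel_id: "L \<in> carrier_mat n n \<Longrightarrow> relabel n id id L = L"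
  by (intro eq_matI) (auto simp: relabel_def)

lemma index_relabel:
  "i < n \<Longrightarrow> j < n \<Longrightarrow> relabel n s p L $$ (i, j) = s (L $$ (i, p j))"
  by (simp add: relabel_def)

section \<open>Signed counting of normalized unipotent squares\<close>

lemma finite_latin_squares: "finite {L. latin_square n L}"
proof (rule finite_subset)
  show "{L. latin_square n L} \<subseteq> mat n n ` ({0..<n} \<times> {0..<n} \<rightarrow>\<^sub>E {0..<n})"
  proof
    fix L assume "L \<in> {L. latin_square n L}"
    then have "L = mat n n (restrict (($$) L) ({0..<n} \<times> {0..<n}))"
      and "restrict (($$) L) ({0..<n} \<times> {0..<n}) \<in> {0..<n} \<times> {0..<n} \<rightarrow>\<^sub>E {0..<n}"
      by (auto simp: latin_square_def intro!: eq_matI)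
    then show "L \<in> mat n n ` ({0..<n} \<times> {0..<n} \<rightarrow>\<^sub>E {0..<n})" by (rule image_eqI)
  qed
qed (auto intro!: finite_imageI finite_PiE)

definition normalized_unipotent :: "nat \<Rightarrow> nat mat set" where
  "normalized_unipotent n = {L. latin_square n L \<and> normalized n L \<and> unipotent n L}"

lemma latin_sign_cases: "latin_sign n L = 1 \<or> latin_sign n L = - 1"
proof -
  have "\<bar>latin_sign n L\<bar> = 1" by (simp add: latin_sign_def abs_mult abs_prod)
  then show ?thesis by linarith
qed

text \<open>Every sign is \<open>1\<close> or \<open>- 1\<close>, hence a difference of two
  indicators.\<close>

lemma AT_eq_sum: "AT n = (\<Sum>L\<in>normalized_unipotent n. latin_sign n L)"
proof -
  let ?N = "normalized_unipotent n"
  have fin: "finite ?N"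
    by (rule finite_subset[OF _ finite_latin_squares[of n]]) (auto simp: normalized_unipotent_def)
  have "(\<Sum>L\<in>?N. latin_sign n L)
      = (\<Sum>L\<in>?N. of_bool (latin_sign n L = 1) - of_bool (latin_sign n L = - 1))"
    by (rule sum.cong) (use latin_sign_cases[of n] in auto)
  also have "\<dots> = int (card {L \<in> ?N. latin_sign n L = 1}) - int (card {L \<in> ?N. latin_sign n L = - 1})"
    using fin by (simp add: sum_subtractf Collect_conj_eq)
  finally show ?thesis
    by (simp add: AT_def U_even_def U_odd_def normalized_unipotent_def conj_assoc)
qed

text \<open>The constant diagonal entry is the one in cell \<open>(0, 0)\<close>, which
  normalization fixes.\<close>

lemma normalized_unipotent_diag:
  assumes "M \<in> normalized_unipotent n" "i < n"
  shows "M $$ (i, i) = 0"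
proof -
  have "0 < n" using assms(2) by simp
  moreover have "normalized n M" "unipotent n M"
    using assms(1) by (simp_all add: normalized_unipotent_def)
  ultimately show ?thesis
    using assms(2) unfolding normalized_def unipotent_def by metis
qed

lemma sum_latin_squares_sign:
  assumes "odd n"
  shows "(\<Sum>L | latin_square n L. latin_sign n L * sign (symbol_perm n L 0))
    = fact n * fact (n - 1) * AT n"
proof -
  have n: "0 < n" using assms by (cases n) auto
  let ?P = "{p. p permutes {0..<n}}" and ?S = "{s. s permutes {1..<n}}"
    and ?N = "normalized_unipotent n"
  \<comment> \<open>\<open>p L\<close> moves the zeros of \<open>L\<close> to the diagonal,
    \<open>s L\<close> is the first row that results, and undoing \<open>s L\<close> yields the
    normal form \<open>M L\<close>. \<open>R\<close> rebuilds \<open>L\<close> from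
    \<open>(p L, s L, M L)\<close>.\<close>
  define p where "p L = symbol_perm n L 0" for L
  define s where "s L = row_perm n (relabel n id (p L) L) 0" for L
  define M where "M L = relabel n (Hilbert_Choice.inv (s L)) (p L) L" for L
  define R where "R = (\<lambda>(q, r, N). relabel n r (Hilbert_Choice.inv q) N)"
  have p_perm: "p L permutes {0..<n}" if "latin_square n L" for L
    using symbol_perm_permutes[OF that n] by (simp add: p_def)
  have p_diag: "L $$ (i, p L i) = 0" if "latin_square n L" "i < n" for L i
    using symbol_perm_eq_iff[OF that(1) n that(2) symbol_perm_less[OF that(1) n that(2)]]
    by (simp add: p_def)
  have s_perm: "s L permutes {0..<n}" if "latin_square n L" for L
    using latin_square_relabel[OF permutes_id p_perm[OF that] that] n
    by (simp add: latin_square_iff_permutes s_def)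
  have s_app: "s L j = L $$ (0, p L j)" if "j < n" for L j
    using that n by (simp add: s_def row_perm_def index_relabel)
  \<comment> \<open>With the zeros on the diagonal the first row starts with \<open>0\<close>. Hence
    undoing \<open>s L\<close> keeps the diagonal zero, and \<open>s L\<close> ranges over
    permutations of \<open>n - 1\<close> symbols only.\<close>
  have s_zero: "s L 0 = 0" if "latin_square n L" for L
    using p_diag[OF that n] s_app[OF n] by simp
  have s_perm1: "s L permutes {1..<n}" if L: "latin_square n L" for L
  proof (rule permutes_superset[OF s_perm[OF L]])
    fix x assume "x \<in> {0..<n} - {1..<n}"
    then show "s L x = x" using s_zero[OF L] by (cases x) auto
  qed
  have perm0: "r permutes {0..<n}" if "r permutes {1..<n}" for r :: "nat \<Rightarrow> nat"
    using that by (rule permutes_subset) auto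
  have M_latin: "latin_square n (M L)" if "latin_square n L" for L
    unfolding M_def by (rule latin_square_relabel[OF permutes_inv[OF s_perm] p_perm]) fact+
  have M_in: "M L \<in> ?N" if L: "latin_square n L" for L
  proof -
    have "M L $$ (i, i) = 0" if "i < n" for i
      using p_diag[OF L that] s_zero[OF L] that permutes_inverses(2)[OF s_perm[OF L], of 0]
      by (simp add: M_def index_relabel)
    moreover have "M L $$ (0, j) = j" if "j < n" for j
      using n that permutes_inverses(2)[OF s_perm[OF L], of j]
      by (simp add: M_def index_relabel flip: s_app)
    ultimately show ?thesis
      using M_latin[OF L] by (simp add: normalized_unipotent_def normalized_def unipotent_def)
  qed
  have sign_eq: "latin_sign n (M L) = latin_sign n L * sign (symbol_perm n L 0)"
    if L: "latin_square n L" for L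
  proof -
    \<comment> \<open>Oddness of \<open>n\<close> enters here: the \<open>n\<close> row factors
      collapse to one.\<close>
    have "sign (p L) ^ n = sign (p L)"
      using assms by (cases "p L" rule: sign_cases) auto
    then show ?thesis
      using latin_sign_relabel[OF permutes_inv[OF s_perm[OF L]] p_perm[OF L] L]
      by (simp add: M_def p_def)
  qed
  have R_latin: "latin_square n (R (q, r, N))"
    if "q permutes {0..<n}" "r permutes {1..<n}" "N \<in> ?N" for q r N
    using latin_square_relabel[OF perm0[OF that(2)] permutes_inv[OF that(1)]] that(3)
    by (simp add: R_def normalized_unipotent_def)
  \<comment> \<open>As \<open>r\<close> fixes \<open>0\<close>, the zero of \<open>N\<close> in cell
    \<open>(i, i)\<close> ends up as a zero in cell \<open>(i, q i)\<close>.\<close>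
  have pR: "p (R (q, r, N)) = q"
    if q: "q permutes {0..<n}" and r: "r permutes {1..<n}" and N: "N \<in> ?N" for q r N
  proof
    fix i
    show "p (R (q, r, N)) i = q i"
    proof (cases "i < n")
      case True
      have qi: "q i < n" using permutes_in_image[OF q, of i] True by simp
      have "R (q, r, N) $$ (i, q i) = r (N $$ (i, i))"
        using True qi permutes_inverses(2)[OF q] by (simp add: R_def index_relabel)
      also have "\<dots> = 0"
        using normalized_unipotent_diag[OF N True] permutes_not_in[OF r, of 0] by simp
      finally show ?thesis
        using symbol_perm_eq_iff[OF R_latin[OF that] n True qi] by (simp add: p_def)
    next
      case False
      then show ?thesis using permutes_not_in[OF q] by (simp add: p_def symbol_perm_def)
    qed
  qed
  \<comment> \<open>Moving the columns back by \<open>q\<close> leaves the first row of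
    \<open>N\<close>, the identity, renamed by \<open>r\<close>.\<close>
  have sR: "s (R (q, r, N)) = r"
    if q: "q permutes {0..<n}" and r: "r permutes {1..<n}" and N: "N \<in> ?N" for q r N
  proof
    fix j
    show "s (R (q, r, N)) j = r j"
    proof (cases "j < n")
      case True
      have qj: "q j < n" using permutes_in_image[OF q, of j] True by simp
      have "N $$ (0, j) = j" using N True by (simp add: normalized_unipotent_def normalized_def)
      then show ?thesis
        using True qj n permutes_inverses(2)[OF q]
        by (simp add: s_app pR[OF that]) (simp add: R_def index_relabel)
    next
      case False
      then show ?thesis
        using permutes_not_in[OF r, of j] by (simp add: s_def row_perm_def)
    qed
  qed
  have "(\<Sum>L | latin_square n L. latin_sign n L * sign (symbol_perm n L 0))
      = (\<Sum>(q, r, N)\<in>?P \<times> ?S \<times> ?N. latin_sign n N)"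
  proof (rule sum.reindex_bij_witness[of _ R "\<lambda>L. (p L, s L, M L)"])
    fix L assume "L \<in> {L. latin_square n L}"
    then have L: "latin_square n L" by simp
    show "R (p L, s L, M L) = L"
      using relabel_relabel[OF permutes_inv[OF p_perm[OF L]], of "s L" "Hilbert_Choice.inv (s L)" "p L" L]
        permutes_inv_o(1)[OF p_perm[OF L]] permutes_inv_o(1)[OF s_perm[OF L]] relabel_id L
      by (simp add: R_def M_def latin_square_def)
    show "(p L, s L, M L) \<in> ?P \<times> ?S \<times> ?N"
      using p_perm s_perm1 M_in L by simp
    show "(case (p L, s L, M L) of (q, r, N) \<Rightarrow> latin_sign n N)
        = latin_sign n L * sign (symbol_perm n L 0)"
      using sign_eq[OF L] by simp
  next
    fix t assume "t \<in> ?P \<times> ?S \<times> ?N"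
    then obtain q r N where t: "t = (q, r, N)"
      and q: "q permutes {0..<n}" and r: "r permutes {1..<n}" and N: "N \<in> ?N" by auto
    show "R t \<in> {L. latin_square n L}" using R_latin[OF q r N] t by simp
    have "M (R t) = relabel n (Hilbert_Choice.inv r) q (relabel n r (Hilbert_Choice.inv q) N)"
      by (simp add: M_def t pR[OF q r N] sR[OF q r N]) (simp add: R_def)
    also have "\<dots> = N"
      using relabel_relabel[OF q] permutes_inv_o(2)[OF q] permutes_inv_o(2)[OF r] relabel_id N
      by (simp add: normalized_unipotent_def latin_square_def)
    finally show "(p (R t), s (R t), M (R t)) = t"
      by (simp add: t pR[OF q r N] sR[OF q r N])
  qed
  \<comment> \<open>The summand depends on \<open>N\<close> alone, so the choices of
    \<open>q\<close> and \<open>r\<close> only contribute their number.\<close>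
  also have "\<dots> = int (card ?P) * (int (card ?S) * AT n)"
    by (simp add: sum.cartesian_product[symmetric] AT_eq_sum)
  also have "card ?P = fact n" by (simp add: card_permutations)
  also have "card ?S = fact (n - 1)" by (simp add: card_permutations)
  finally show ?thesis by (simp add: mult.assoc)
qed

subsection \<open>The coefficient as a sum over Latin squares\<close>

text \<open>The exponent vector of the Leibniz term of \<open>p\<close>: the indicator of the graph
  of \<open>p\<close>.\<close>

definition perm_monom :: "nat \<Rightarrow> (nat \<Rightarrow> nat) \<Rightarrow> (nat \<times> nat) \<Rightarrow>\<^sub>0 nat" where
  "perm_monom n p = (\<Sum>i<n. Poly_Mapping.single (i, p i) 1)"

lemma prod_single:
  fixes g :: "'b \<Rightarrow> 'c :: comm_semiring_1" and f :: "'b \<Rightarrow> 'a :: comm_monoid_add"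
  shows "(\<Prod>k\<in>A. Poly_Mapping.single (f k) (g k)) = Poly_Mapping.single (\<Sum>k\<in>A. f k) (\<Prod>k\<in>A. g k)"
  by (induction A rule: infinite_finite_induct) (auto simp: mult_single)

lemma prod_X_mat:
  assumes "p permutes {0..<n}"
  shows "(\<Prod>i = 0..<n. X_mat n $$ (i, p i)) = Poly_Mapping.single (perm_monom n p) 1"
proof -
  have "p i < n" if "i < n" for i
    using permutes_in_image[OF assms, of i] that by simp
  then have "(\<Prod>i = 0..<n. X_mat n $$ (i, p i)) = (\<Prod>i<n. mvar (i, p i))"
    unfolding atLeast0LessThan by (intro prod.cong refl) (simp add: X_mat_def)
  then show ?thesis by (simp add: mvar_def prod_single perm_monom_def)
qed

lemma per_X_mat:
  "per (X_mat n) = (\<Sum>p | p permutes {0..<n}. Poly_Mapping.single (perm_monom n p) 1)"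
proof -
  have "dim_row (X_mat n) = n" "dim_col (X_mat n) = n" by (simp_all add: X_mat_def)
  then show ?thesis by (simp add: per_def prod_X_mat)
qed

lemma det_X_mat:
  "det (X_mat n) = (\<Sum>p | p permutes {0..<n}. Poly_Mapping.single (perm_monom n p) (of_int (sign p)))"
proof -
  have "X_mat n \<in> carrier_mat n n" by (simp add: X_mat_def)
  then show ?thesis
    by (simp add: det_def' prod_X_mat mult_single flip: single_of_int)
qed

section \<open>Families of permutations that cover each cell once\<close>

lemma lookup_sum_perm_monom:
  "Poly_Mapping.lookup (\<Sum>k<n. perm_monom n (P k)) (i, j)
    = (if i < n then card {k. k < n \<and> P k i = j} else 0)"
proof -
  have "Poly_Mapping.lookup (perm_monom n (P k)) (i, j) = (if i < n then of_bool (P k i = j) else 0)" for k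
  proof -
    have "Poly_Mapping.lookup (perm_monom n (P k)) (i, j)
        = (\<Sum>i'<n. if i' = i then of_bool (P k i = j) else 0)"
      unfolding perm_monom_def lookup_sum lookup_single
      by (rule sum.cong) (auto simp: when_def)
    then show ?thesis by simp
  qed
  then show ?thesis by (simp add: lookup_sum Int_def)
qed

lemma lookup_all_vars_monom:
  "Poly_Mapping.lookup (all_vars_monom n) (i, j) = of_bool (i < n \<and> j < n)"
proof -
  have "Poly_Mapping.lookup (all_vars_monom n) (i, j)
      = (\<Sum>i'<n. if i' = i then \<Sum>j'<n. if j' = j then 1 else 0 else 0)"
    unfolding all_vars_monom_def lookup_sum lookup_single
    by (intro sum.cong refl) (auto simp: when_def)
  then show ?thesis by simp
qed

text \<open>The exponent at a cell counts the permutations whose graph passes through it, so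
  equality says that every cell is covered exactly once.\<close>

lemma sum_perm_monom_eq_all_vars_iff:
  assumes "\<And>k. k < n \<Longrightarrow> P k permutes {0..<n}"
  shows "(\<Sum>k<n. perm_monom n (P k)) = all_vars_monom n
    \<longleftrightarrow> (\<forall>i<n. \<forall>j<n. \<exists>!k. k < n \<and> P k i = j)" (is "?m = _ \<longleftrightarrow> ?R")
proof -
  \<comment> \<open>Exponents are compared at all pairs of numbers, so cells to the right of the
    grid need a separate argument.\<close>
  have empty: "{k. k < n \<and> P k i = j} = {}" if "i < n" "\<not> j < n" for i j
    using that permutes_in_image[OF assms] by auto
  have "?m = all_vars_monom n \<longleftrightarrow> (\<forall>i j. Poly_Mapping.lookup ?m (i, j)
      = Poly_Mapping.lookup (all_vars_monom n) (i, j))"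
    by (simp add: poly_mapping_eq_iff fun_eq_iff)
  also have "\<dots> \<longleftrightarrow> (\<forall>i<n. \<forall>j<n. card {k. k < n \<and> P k i = j} = Suc 0)"
    unfolding lookup_sum_perm_monom lookup_all_vars_monom using empty by auto
  also have "\<dots> \<longleftrightarrow> ?R" by (simp add: card_eq_Suc_0_iff_is_singleton is_singleton_iff_ex1)
  finally show ?thesis .
qed

text \<open>Partitions of the grid into \<open>n\<close> labelled permutation graphs. Extensional
  functions make a family determined by its values below \<open>n\<close>, and they index the
  expansion of a product of sums.\<close>

definition perm_decompositions :: "nat \<Rightarrow> (nat \<Rightarrow> nat \<Rightarrow> nat) set" where
  "perm_decompositions n = {P \<in> {..<n} \<rightarrow>\<^sub>E {p. p permutes {0..<n}}.
     \<forall>i<n. \<forall>j<n. \<exists>!k. k < n \<and> P k i = j}"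

definition square_of_perms :: "nat \<Rightarrow> (nat \<Rightarrow> nat \<Rightarrow> nat) \<Rightarrow> nat mat" where
  "square_of_perms n P = mat n n (\<lambda>(i, j). THE k. k < n \<and> P k i = j)"

lemma square_of_perms_eq_iff:
  assumes "P \<in> perm_decompositions n" "i < n" "j < n" "k < n"
  shows "square_of_perms n P $$ (i, j) = k \<longleftrightarrow> P k i = j"
proof -
  have "\<exists>!k. k < n \<and> P k i = j" using assms by (simp add: perm_decompositions_def)
  from theI'[OF this] the1_equality[OF this, of k] show ?thesis
    using assms(2-4) by (auto simp: square_of_perms_def)
qed

text \<open>Symbol \<open>k\<close> stands in row \<open>i\<close> exactly at column
  \<open>P k i\<close>, and in column \<open>j\<close> exactly at the row given by the inverse of
  \<open>P k\<close>.\<close>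

lemma latin_square_square_of_perms:
  assumes P: "P \<in> perm_decompositions n"
  shows "latin_square n (square_of_perms n P)"
  unfolding latin_square_def
proof (intro conjI allI impI)
  show "square_of_perms n P \<in> carrier_mat n n" by (simp add: square_of_perms_def)
next
  fix i j assume ij: "i < n" "j < n"
  then have "\<exists>!k. k < n \<and> P k i = j" using P by (simp add: perm_decompositions_def)
  from theI'[OF this] show "square_of_perms n P $$ (i, j) < n"
    using ij by (simp add: square_of_perms_def)
next
  fix i k assume ik: "i < n" "k < n"
  have "P k permutes {0..<n}" using P ik by (auto simp: perm_decompositions_def)
  then have "P k i < n" using permutes_in_image[of "P k" "{0..<n}" i] ik by simp
  then show "\<exists>!j. j < n \<and> square_of_perms n P $$ (i, j) = k"
    using square_of_perms_eq_iff[OF P ik(1) _ ik(2)] by (intro ex1I[of _ "P k i"]) (simp, metis)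
next
  fix j k assume jk: "j < n" "k < n"
  have perm: "P k permutes {0..<n}" using P jk by (auto simp: perm_decompositions_def)
  have "Hilbert_Choice.inv (P k) j < n" using permutes_in_image[OF permutes_inv[OF perm], of j] jk by simp
  then show "\<exists>!i. i < n \<and> square_of_perms n P $$ (i, j) = k"
    using square_of_perms_eq_iff[OF P _ jk] permutes_inverses[OF perm]
    by (intro ex1I[of _ "Hilbert_Choice.inv (P k) j"]) (simp, metis)
qed

lemma symbol_perm_in_perm_decompositions:
  assumes L: "latin_square n L"
  shows "restrict (symbol_perm n L) {..<n} \<in> perm_decompositions n"
proof -
  have "\<exists>!k. k < n \<and> restrict (symbol_perm n L) {..<n} k i = j" if "i < n" "j < n" for i j
    using symbol_perm_eq_iff[OF L _ that] latin_square_entry_less[OF L that]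
    by (intro ex1I[of _ "L $$ (i, j)"]) (simp, metis lessThan_iff restrict_apply')
  then show ?thesis
    using symbol_perm_permutes[OF L] by (simp add: perm_decompositions_def)
qed

lemma sum_perm_decompositions:
  fixes w :: "nat \<Rightarrow> (nat \<Rightarrow> nat) \<Rightarrow> 'a :: comm_semiring_1"
  shows "(\<Sum>P\<in>perm_decompositions n. \<Prod>k<n. w k (P k))
    = (\<Sum>L | latin_square n L. \<Prod>k<n. w k (symbol_perm n L k))"
proof (rule sum.reindex_bij_witness[of _ "\<lambda>L. restrict (symbol_perm n L) {..<n}" "square_of_perms n"])
  fix P assume P: "P \<in> perm_decompositions n"
  note latin = latin_square_square_of_perms[OF P]
  show "square_of_perms n P \<in> {L. latin_square n L}" using latin by simp
  have eq: "symbol_perm n (square_of_perms n P) k = P k" if k: "k < n" for k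
  proof
    fix i
    have perm: "P k permutes {0..<n}" using P k by (auto simp: perm_decompositions_def)
    show "symbol_perm n (square_of_perms n P) k i = P k i"
    proof (cases "i < n")
      case True
      then have "P k i < n" using permutes_in_image[OF perm, of i] by simp
      then show ?thesis
        using symbol_perm_eq_iff[OF latin k True] square_of_perms_eq_iff[OF P True _ k] by simp
    next
      case False
      then show ?thesis using permutes_not_in[OF perm] by (simp add: symbol_perm_def)
    qed
  qed
  then show "(\<Prod>k<n. w k (symbol_perm n (square_of_perms n P) k)) = (\<Prod>k<n. w k (P k))" by simp
  \<comment> \<open>Extensionality settles the indices from \<open>n\<close> on, where the symbol
    permutations say nothing about \<open>P\<close>.\<close>
  have "P \<in> extensional {..<n}" using P by (auto simp: perm_decompositions_def PiE_def)
  then show "restrict (symbol_perm n (square_of_perms n P)) {..<n} = P"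
    using eq by (auto simp: extensional_def restrict_def fun_eq_iff)
next
  fix L assume "L \<in> {L. latin_square n L}"
  then have L: "latin_square n L" by simp
  note P = symbol_perm_in_perm_decompositions[OF L]
  then show "restrict (symbol_perm n L) {..<n} \<in> perm_decompositions n" .
  show "square_of_perms n (restrict (symbol_perm n L) {..<n}) = L"
  proof (rule eq_matI)
    fix i j assume "i < dim_row L" "j < dim_col L"
    then have ij: "i < n" "j < n" using L by (auto simp: latin_square_def)
    note k = latin_square_entry_less[OF L ij]
    show "square_of_perms n (restrict (symbol_perm n L) {..<n}) $$ (i, j) = L $$ (i, j)"
      using square_of_perms_eq_iff[OF P ij k] symbol_perm_eq_iff[OF L k ij] k by simp
  qed (use L in \<open>auto simp: square_of_perms_def latin_square_def\<close>)
qed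

text \<open>Expanding picks one permutation per factor, and the coefficient keeps the picks that
  partition the grid. The weight depends on the factor so that permanent and determinants fit one
  product.\<close>

lemma lookup_prod_perm_monom:
  fixes w :: "nat \<Rightarrow> (nat \<Rightarrow> nat) \<Rightarrow> 'a :: comm_semiring_1"
  shows "Poly_Mapping.lookup
      (\<Prod>k<n. \<Sum>p | p permutes {0..<n}. Poly_Mapping.single (perm_monom n p) (w k p)) (all_vars_monom n)
    = (\<Sum>L | latin_square n L. \<Prod>k<n. w k (symbol_perm n L k))"
proof -
  let ?T = "{..<n} \<rightarrow>\<^sub>E {p. p permutes {0..<n}}"
  have fin: "finite {p. p permutes {0..<n}}" by (simp add: finite_permutations)
  then have finT: "finite ?T" by (simp add: finite_PiE)
  have "Poly_Mapping.lookup
      (\<Prod>k<n. \<Sum>p | p permutes {0..<n}. Poly_Mapping.single (perm_monom n p) (w k p)) (all_vars_monom n)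
    = (\<Sum>P\<in>?T. (\<Prod>k<n. w k (P k)) when (\<Sum>k<n. perm_monom n (P k)) = all_vars_monom n)"
    using fin by (simp add: prod_sum_PiE prod_single lookup_sum lookup_single)
  also have "\<dots> = (\<Sum>P\<in>?T. if P \<in> perm_decompositions n then \<Prod>k<n. w k (P k) else 0)"
  proof (rule sum.cong)
    fix P assume P: "P \<in> ?T"
    then have "P k permutes {0..<n}" if "k < n" for k using that by auto
    from sum_perm_monom_eq_all_vars_iff[OF this] P
    show "((\<Prod>k<n. w k (P k)) when (\<Sum>k<n. perm_monom n (P k)) = all_vars_monom n)
        = (if P \<in> perm_decompositions n then \<Prod>k<n. w k (P k) else 0)"
      by (simp add: perm_decompositions_def when_def)
  qed simp
  also have "\<dots> = (\<Sum>P\<in>perm_decompositions n. \<Prod>k<n. w k (P k))"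
    using finT by (intro sum.mono_neutral_cong_right) (auto simp: perm_decompositions_def)
  finally show ?thesis by (simp add: sum_perm_decompositions)
qed

section \<open>Evaluation of the coefficient\<close>

lemma lookup_mconst_mult:
  fixes c :: "'a :: comm_semiring_1"
  shows "Poly_Mapping.lookup (mconst c * f) m = c * Poly_Mapping.lookup f m"
  by (simp add: mconst_def Poly_Mapping.map.rep_eq when_def flip: mult_map_scale_conv_mult)

theorem theorem4:
  fixes n :: nat
  assumes "odd n"
  shows "Poly_Mapping.lookup (mconst (1 / (fact n * fact (n - 1))) * per (X_mat n) * det (X_mat n) ^ (n - 1))
           (all_vars_monom n)
         = (- 1) ^ (n * (n - 1) div 2) * of_int (AT n)"
proof -
  obtain m where m: "n = Suc m" using assms by (cases n) auto
  \<comment> \<open>Factor \<open>0\<close> is the permanent, with weight \<open>1\<close>; the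
    other \<open>n - 1\<close> factors are determinants. Thus the unsigned symbol is
    \<open>0\<close>, the one that normal forms carry on the diagonal.\<close>
  define w where "w k p = (if k = 0 then 1 else of_int (sign p) :: rat)" for k :: nat and p :: "nat \<Rightarrow> nat"
  let ?e = "(- 1) ^ (n * (n - 1) div 2) :: int"
  have "per (X_mat n) * det (X_mat n) ^ (n - 1)
      = (\<Prod>k<n. \<Sum>p | p permutes {0..<n}. Poly_Mapping.single (perm_monom n p) (w k p))"
    unfolding per_X_mat det_X_mat w_def m prod.lessThan_Suc_shift by simp
  then have "Poly_Mapping.lookup (per (X_mat n) * det (X_mat n) ^ (n - 1)) (all_vars_monom n)
      = (\<Sum>L | latin_square n L. \<Prod>k<n. w k (symbol_perm n L k))"
    by (simp add: lookup_prod_perm_monom)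
  also have "\<dots> = (\<Sum>L | latin_square n L. of_int (?e * (latin_sign n L * sign (symbol_perm n L 0))))"
  proof (rule sum.cong)
    fix L assume "L \<in> {L. latin_square n L}"
    then have "?e * (latin_sign n L * sign (symbol_perm n L 0))
        = (\<Prod>k<n. sign (symbol_perm n L k)) * sign (symbol_perm n L 0)"
      by (simp add: prod_symbol_perm_sign)
    \<comment> \<open>The sign for symbol \<open>0\<close> now occurs twice and cancels.\<close>
    also have "\<dots> = (\<Prod>k<m. sign (symbol_perm n L (Suc k)))"
      unfolding m prod.lessThan_Suc_shift by (simp add: mult_ac)
    also have "of_int \<dots> = (\<Prod>k<n. w k (symbol_perm n L k))"
      unfolding m prod.lessThan_Suc_shift by (simp add: w_def)
    finally show "(\<Prod>k<n. w k (symbol_perm n L k))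
        = of_int (?e * (latin_sign n L * sign (symbol_perm n L 0)))" by simp
  qed simp
  also have "\<dots> = of_int (?e * (\<Sum>L | latin_square n L. latin_sign n L * sign (symbol_perm n L 0)))"
    by (simp add: sum_distrib_left)
  also have "\<dots> = fact n * fact (n - 1) * ((- 1) ^ (n * (n - 1) div 2) * of_int (AT n))"
    by (simp add: sum_latin_squares_sign[OF assms])
  finally show ?thesis
    by (simp add: mult.assoc lookup_mconst_mult)
qed

end
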